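(* Let $A$ be a $B_1$-algebra and define $Nil(A):=\{x\in A\mid (\exists n\geq 1)\ x^n=0\}$. Then $Nil(A)$ is a saturated ideal of $A$, and $$\bigcap_{\mathcal P\in Pr(A)}\mathcal P=\bigcap_{\mathcal P\in Pr_s(A)}\mathcal P=Nil(A).$$
   Context: A (commutative) $B_1$-algebra is a commutative semiring $A$ with $0$ (absorbing for multiplication) and $1$, in which $1+1=1$ (so $x+x=x$ for all $x\in A$). An ideal of $A$ is a subset containing $0$, stable under addition and under multiplication by elements of $A$. An ideal $\mathcal P$ is prime if $\mathcal P\neq A$ and $ab\in\mathcal P$ implies $a\in\mathcal P$ or $b\in\mathcal P$. A congruence on $A$ is an equivalence relation compatible with addition and multiplication. For a congruence $\mathcal R$, $I(\mathcal R):=\{x\in A\mid x\,\mathcal R\,0\}$, an ideal. An ideal $J$ is saturated if $J=I(\mathcal R)$ for some congruence $\mathcal R$. $Pr(A)$ is the set of prime ideals of $A$ and $Pr_s(A)$ the set of saturated prime ideals. An empty intersection of ideals of $A$ is $A$. *)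

theory Defs
  imports "HOL-Algebra.Ring"
begin

text \<open>
  The library locale \<open>semiring\<close> has an absorbing zero and a unit, and does not
  require zero and one to be distinct; the trivial algebra is thus included.
\<close>

locale B1_algebra = semiring A + comm_monoid A for A (structure) +
  assumes one_add_one: "\<one> \<oplus> \<one> = \<one>"

text \<open>
  The library predicate \<open>ideal\<close> presupposes a ring (additive inverses), so ideals
  of semirings are defined separately.
\<close>

definition semiring_ideal :: "('a, 'm) ring_scheme \<Rightarrow> 'a set \<Rightarrow> bool" where
  "semiring_ideal A J \<longleftrightarrow>
     J \<subseteq> carrier A \<and> \<zero>\<^bsub>A\<^esub> \<in> J \<and>
     (\<forall>x\<in>J. \<forall>y\<in>J. x \<oplus>\<^bsub>A\<^esub> y \<in> J) \<and>
     (\<forall>a\<in>carrier A. \<forall>x\<in>J. a \<otimes>\<^bsub>A\<^esub> x \<in> J)"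

definition prime_ideal :: "('a, 'm) ring_scheme \<Rightarrow> 'a set \<Rightarrow> bool" where
  "prime_ideal A P \<longleftrightarrow>
     semiring_ideal A P \<and> P \<noteq> carrier A \<and>
     (\<forall>a\<in>carrier A. \<forall>b\<in>carrier A. a \<otimes>\<^bsub>A\<^esub> b \<in> P \<longrightarrow> a \<in> P \<or> b \<in> P)"

definition semiring_congruence :: "('a, 'm) ring_scheme \<Rightarrow> ('a \<times> 'a) set \<Rightarrow> bool" where
  "semiring_congruence A R \<longleftrightarrow>
     equiv (carrier A) R \<and>
     (\<forall>a b c d. (a, b) \<in> R \<longrightarrow> (c, d) \<in> R \<longrightarrow>
        (a \<oplus>\<^bsub>A\<^esub> c, b \<oplus>\<^bsub>A\<^esub> d) \<in> R \<and> (a \<otimes>\<^bsub>A\<^esub> c, b \<otimes>\<^bsub>A\<^esub> d) \<in> R)"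

definition congruence_ideal :: "('a, 'm) ring_scheme \<Rightarrow> ('a \<times> 'a) set \<Rightarrow> 'a set" where
  "congruence_ideal A R = {x \<in> carrier A. (x, \<zero>\<^bsub>A\<^esub>) \<in> R}"

definition saturated_ideal :: "('a, 'm) ring_scheme \<Rightarrow> 'a set \<Rightarrow> bool" where
  "saturated_ideal A J \<longleftrightarrow>
     semiring_ideal A J \<and> (\<exists>R. semiring_congruence A R \<and> J = congruence_ideal A R)"

definition Pr :: "('a, 'm) ring_scheme \<Rightarrow> 'a set set" where
  "Pr A = {P. prime_ideal A P}"

definition Pr_s :: "('a, 'm) ring_scheme \<Rightarrow> 'a set set" where
  "Pr_s A = {P. prime_ideal A P \<and> saturated_ideal A P}"

text \<open>
  Intersecting with the carrier realizes the convention that an empty intersection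
  of ideals of \<open>A\<close> is \<open>A\<close>; it has no effect on nonempty families of ideals.
\<close>

definition ideal_Inter :: "('a, 'm) ring_scheme \<Rightarrow> 'a set set \<Rightarrow> 'a set" where
  "ideal_Inter A F = carrier A \<inter> \<Inter>F"

definition Nil_set :: "('a, 'm) ring_scheme \<Rightarrow> 'a set" where
  "Nil_set A = {x \<in> carrier A. \<exists>n::nat. n \<ge> 1 \<and> x [^]\<^bsub>A\<^esub> n = \<zero>\<^bsub>A\<^esub>}"

end

theory Submission
  imports Defs
begin

text \<open>
  Since addition is idempotent, a sum lies above each of its summands. The ideals that are closed
  downwards are saturated, being the zero class of their syntactic congruence, and \<open>{\<zero>}\<close> is one
  of them. If \<open>x\<close> is not nilpotent, Zorn's lemma yields a downward closed ideal \<open>P\<close> maximal among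
  those containing no power of \<open>x\<close>. It is prime: if \<open>a \<otimes> b \<in> P\<close> with \<open>a, b \<notin> P\<close>, maximality
  applied to the colon ideal \<open>(P : b)\<close> gives \<open>x\<^sup>n \<otimes> b \<in> P\<close>, and then applied to \<open>(P : x\<^sup>n)\<close> it
  gives \<open>x\<^sup>m\<^sup>+\<^sup>n \<in> P\<close>. So the nilpotents form an intersection of downward closed ideals, which makes
  them a saturated ideal without any binomial expansion.
\<close>

text \<open>The last condition is closure downwards for the order in which \<open>x\<close> lies
  below \<open>z\<close> when \<open>x \<oplus> z = z\<close>: by idempotence the elements above
  \<open>x\<close> are exactly the sums \<open>x \<oplus> y\<close>.\<close>

definition strong_ideal :: "('a, 'm) ring_scheme \<Rightarrow> 'a set \<Rightarrow> bool" where
  "strong_ideal A J \<longleftrightarrow> semiring_ideal A J \<and>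
     (\<forall>x\<in>carrier A. \<forall>y\<in>carrier A. x \<oplus>\<^bsub>A\<^esub> y \<in> J \<longrightarrow> x \<in> J)"

text \<open>For \<open>J\<close> inside the carrier of a commutative semiring, this is the largest
  congruence having \<open>J\<close> as a union of classes. The contexts are all maps sending
  \<open>x\<close> to \<open>c \<otimes> x \<oplus> d\<close>.\<close>

definition syntactic_congruence :: "('a, 'm) ring_scheme \<Rightarrow> 'a set \<Rightarrow> ('a \<times> 'a) set" where
  "syntactic_congruence A J = {(x, y). x \<in> carrier A \<and> y \<in> carrier A \<and>
     (\<forall>c\<in>carrier A. \<forall>d\<in>carrier A. c \<otimes>\<^bsub>A\<^esub> x \<oplus>\<^bsub>A\<^esub> d \<in> J \<longleftrightarrow> c \<otimes>\<^bsub>A\<^esub> y \<oplus>\<^bsub>A\<^esub> d \<in> J)}"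

section \<open>Closure properties of downward closed ideals\<close>

lemma strong_idealI:
  assumes "J \<subseteq> carrier A" "\<zero>\<^bsub>A\<^esub> \<in> J"
    and "\<And>x y. x \<in> J \<Longrightarrow> y \<in> J \<Longrightarrow> x \<oplus>\<^bsub>A\<^esub> y \<in> J"
    and "\<And>a x. a \<in> carrier A \<Longrightarrow> x \<in> J \<Longrightarrow> a \<otimes>\<^bsub>A\<^esub> x \<in> J"
    and "\<And>x y. x \<in> carrier A \<Longrightarrow> y \<in> carrier A \<Longrightarrow> x \<oplus>\<^bsub>A\<^esub> y \<in> J \<Longrightarrow> x \<in> J"
  shows "strong_ideal A J"
  unfolding strong_ideal_def semiring_ideal_def
  by (intro conjI ballI impI) (fact assms(1,2) | erule (1) assms(3,4) | erule (2) assms(5))+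

lemma
  assumes "strong_ideal A J"
  shows strong_ideal_subset: "J \<subseteq> carrier A"
    and strong_ideal_zero: "\<zero>\<^bsub>A\<^esub> \<in> J"
    and strong_ideal_add: "x \<in> J \<Longrightarrow> y \<in> J \<Longrightarrow> x \<oplus>\<^bsub>A\<^esub> y \<in> J"
    and strong_ideal_mult: "a \<in> carrier A \<Longrightarrow> x \<in> J \<Longrightarrow> a \<otimes>\<^bsub>A\<^esub> x \<in> J"
    and strong_ideal_addD1: "x \<in> carrier A \<Longrightarrow> y \<in> carrier A \<Longrightarrow> x \<oplus>\<^bsub>A\<^esub> y \<in> J \<Longrightarrow> x \<in> J"
proof -
  have J: "semiring_ideal A J" using assms by (simp add: strong_ideal_def)
  then show "J \<subseteq> carrier A" "\<zero>\<^bsub>A\<^esub> \<in> J" by (simp_all add: semiring_ideal_def)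
  show "x \<oplus>\<^bsub>A\<^esub> y \<in> J" if "x \<in> J" "y \<in> J"
    using J that by (simp add: semiring_ideal_def)
  show "a \<otimes>\<^bsub>A\<^esub> x \<in> J" if "a \<in> carrier A" "x \<in> J"
    using J that by (simp add: semiring_ideal_def)
  show "x \<in> J" if "x \<in> carrier A" "y \<in> carrier A" "x \<oplus>\<^bsub>A\<^esub> y \<in> J"
    using assms that unfolding strong_ideal_def by metis
qed

text \<open>Supplies the upper bounds for Zorn's lemma. Comparability puts two summands into a
  common member of the chain.\<close>

lemma strong_ideal_Union_chain:
  assumes "C \<noteq> {}" and "\<And>J. J \<in> C \<Longrightarrow> strong_ideal A J"
    and chain: "\<And>I J. I \<in> C \<Longrightarrow> J \<in> C \<Longrightarrow> I \<subseteq> J \<or> J \<subseteq> I"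
  shows "strong_ideal A (\<Union>C)"
proof (rule strong_idealI)
  fix x y assume "x \<in> \<Union>C" "y \<in> \<Union>C"
  then obtain I J where "x \<in> I" "I \<in> C" "y \<in> J" "J \<in> C" by blast
  with chain[of I J] obtain K where "K \<in> C" "x \<in> K" "y \<in> K" by blast
  with assms(2)[of K] strong_ideal_add[of A K x y] show "x \<oplus>\<^bsub>A\<^esub> y \<in> \<Union>C" by blast
next
  show "\<Union>C \<subseteq> carrier A" using assms(2) strong_ideal_subset by blast
  show "\<zero>\<^bsub>A\<^esub> \<in> \<Union>C" using assms(1,2) strong_ideal_zero by blast
next
  fix a x assume "a \<in> carrier A" "x \<in> \<Union>C"
  then show "a \<otimes>\<^bsub>A\<^esub> x \<in> \<Union>C" using assms(2) by (auto intro: strong_ideal_mult)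
next
  fix x y assume "x \<in> carrier A" "y \<in> carrier A" "x \<oplus>\<^bsub>A\<^esub> y \<in> \<Union>C"
  then show "x \<in> \<Union>C" using assms(2) by (auto dest: strong_ideal_addD1)
qed

lemma strong_ideal_ideal_Inter:
  assumes "semiring A" and "\<And>J. J \<in> F \<Longrightarrow> strong_ideal A J"
  shows "strong_ideal A (ideal_Inter A F)"
proof -
  interpret semiring A by fact
  show ?thesis
  proof (rule strong_idealI)
    fix x y assume "x \<in> carrier A" "y \<in> carrier A" "x \<oplus>\<^bsub>A\<^esub> y \<in> ideal_Inter A F"
    then show "x \<in> ideal_Inter A F"
      using assms(2) by (auto simp: ideal_Inter_def dest: strong_ideal_addD1)
  next
    fix x y assume "x \<in> ideal_Inter A F" "y \<in> ideal_Inter A F"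
    then show "x \<oplus>\<^bsub>A\<^esub> y \<in> ideal_Inter A F"
      using assms(2) by (auto simp: ideal_Inter_def strong_ideal_add)
  next
    fix a x assume "a \<in> carrier A" "x \<in> ideal_Inter A F"
    then show "a \<otimes>\<^bsub>A\<^esub> x \<in> ideal_Inter A F"
      using assms(2) by (auto simp: ideal_Inter_def strong_ideal_mult)
  next
    show "\<zero>\<^bsub>A\<^esub> \<in> ideal_Inter A F"
      using assms(2) by (auto simp: ideal_Inter_def strong_ideal_zero)
  qed (simp add: ideal_Inter_def)
qed

context B1_algebra
begin

section \<open>Saturation through the syntactic congruence\<close>

lemma strong_ideal_add_iff:
  assumes "strong_ideal A J" "x \<in> carrier A" "y \<in> carrier A"
  shows "x \<oplus> y \<in> J \<longleftrightarrow> x \<in> J \<and> y \<in> J"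
  using assms strong_ideal_add[OF assms(1)] strong_ideal_addD1[OF assms(1)] a_comm[of x y]
  by metis

text \<open>The two operands are replaced one at a time. The operand held fixed is absorbed into the
  context: into its additive constant for sums, into its coefficient for products.\<close>

lemma syntactic_congruence: "semiring_congruence A (syntactic_congruence A J)"
proof -
  let ?R = "syntactic_congruence A J"
  have "equiv (carrier A) ?R"
    by (rule equivI)
      (auto simp: syntactic_congruence_def refl_on_def sym_def intro!: transI)
  moreover have "(a \<oplus> c, b \<oplus> d) \<in> ?R" if ab: "(a, b) \<in> ?R" and cd: "(c, d) \<in> ?R" for a b c d
  proof -
    have car: "a \<in> carrier A" "b \<in> carrier A" "c \<in> carrier A" "d \<in> carrier A"
      using ab cd by (auto simp: syntactic_congruence_def)
    have "u \<otimes> (a \<oplus> c) \<oplus> v \<in> J \<longleftrightarrow> u \<otimes> (b \<oplus> d) \<oplus> v \<in> J"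
      if uv: "u \<in> carrier A" "v \<in> carrier A" for u v
    proof -
      have "u \<otimes> (a \<oplus> c) \<oplus> v = u \<otimes> a \<oplus> (u \<otimes> c \<oplus> v)"
        using car uv by (simp add: r_distr a_assoc)
      also have "\<dots> \<in> J \<longleftrightarrow> u \<otimes> b \<oplus> (u \<otimes> c \<oplus> v) \<in> J"
        using ab car uv by (simp add: syntactic_congruence_def)
      also have "u \<otimes> b \<oplus> (u \<otimes> c \<oplus> v) = u \<otimes> c \<oplus> (u \<otimes> b \<oplus> v)"
        using car uv by (simp add: a_lcomm)
      also have "\<dots> \<in> J \<longleftrightarrow> u \<otimes> d \<oplus> (u \<otimes> b \<oplus> v) \<in> J"
        using cd car uv by (simp add: syntactic_congruence_def)
      also have "u \<otimes> d \<oplus> (u \<otimes> b \<oplus> v) = u \<otimes> (b \<oplus> d) \<oplus> v"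
        using car uv by (simp add: r_distr a_assoc a_lcomm)
      finally show ?thesis .
    qed
    with car show ?thesis by (simp add: syntactic_congruence_def)
  qed
  moreover have "(a \<otimes> c, b \<otimes> d) \<in> ?R" if ab: "(a, b) \<in> ?R" and cd: "(c, d) \<in> ?R" for a b c d
  proof -
    have car: "a \<in> carrier A" "b \<in> carrier A" "c \<in> carrier A" "d \<in> carrier A"
      using ab cd by (auto simp: syntactic_congruence_def)
    have "u \<otimes> (a \<otimes> c) \<oplus> v \<in> J \<longleftrightarrow> u \<otimes> (b \<otimes> d) \<oplus> v \<in> J"
      if uv: "u \<in> carrier A" "v \<in> carrier A" for u v
    proof -
      have "u \<otimes> (a \<otimes> c) \<oplus> v = (u \<otimes> a) \<otimes> c \<oplus> v"
        using car uv by (simp add: m_assoc)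
      also have "\<dots> \<in> J \<longleftrightarrow> (u \<otimes> a) \<otimes> d \<oplus> v \<in> J"
        using cd car uv by (simp add: syntactic_congruence_def)
      also have "(u \<otimes> a) \<otimes> d \<oplus> v = (u \<otimes> d) \<otimes> a \<oplus> v"
        using car uv by (simp add: m_ac)
      also have "\<dots> \<in> J \<longleftrightarrow> (u \<otimes> d) \<otimes> b \<oplus> v \<in> J"
        using ab car uv by (simp add: syntactic_congruence_def)
      also have "(u \<otimes> d) \<otimes> b \<oplus> v = u \<otimes> (b \<otimes> d) \<oplus> v"
        using car uv by (simp add: m_ac)
      finally show ?thesis .
    qed
    with car show ?thesis by (simp add: syntactic_congruence_def)
  qed
  ultimately show ?thesis by (simp add: semiring_congruence_def)
qed

text \<open>For \<open>x\<close> in \<open>J\<close>, the element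
  \<open>c \<otimes> x \<oplus> d\<close> lies in \<open>J\<close> exactly when \<open>d\<close>
  does, just as for \<open>\<zero>\<close> in place of \<open>x\<close>; recovering \<open>d\<close>
  from the sum is where downward closure enters.\<close>

lemma strong_ideal_saturated:
  assumes J: "strong_ideal A J"
  shows "saturated_ideal A J"
proof -
  have "x \<in> J \<longleftrightarrow> x \<in> congruence_ideal A (syntactic_congruence A J)" for x
  proof
    assume x: "x \<in> J"
    then have "x \<in> carrier A" using J strong_ideal_subset by blast
    with J x show "x \<in> congruence_ideal A (syntactic_congruence A J)"
      by (auto simp: congruence_ideal_def syntactic_congruence_def strong_ideal_add_iff
          strong_ideal_mult)
  next
    assume "x \<in> congruence_ideal A (syntactic_congruence A J)"
    then have "x \<in> carrier A"
      \<comment> \<open>The context with coefficient \<open>\<one>\<close> and constant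
        \<open>\<zero>\<close> returns \<open>x\<close> itself. The deleted simp rules would rewrite
        this instance before it can be matched with the quantified condition.\<close>
      and "\<one> \<otimes> x \<oplus> \<zero> \<in> J \<longleftrightarrow> \<one> \<otimes> \<zero> \<oplus> \<zero> \<in> J"
      by (auto simp: congruence_ideal_def syntactic_congruence_def
          simp del: l_one r_zero l_zero r_null)
    then show "x \<in> J" using J by (simp add: strong_ideal_zero)
  qed
  then have "J = congruence_ideal A (syntactic_congruence A J)" by blast
  with J syntactic_congruence show ?thesis
    unfolding saturated_ideal_def strong_ideal_def by blast
qed

section \<open>Idempotence, the zero ideal and colon ideals\<close>

lemma add_idem:
  assumes "x \<in> carrier A"
  shows "x \<oplus> x = x"
proof -
  have "x \<oplus> x = (\<one> \<oplus> \<one>) \<otimes> x" using assms by (subst l_distr) auto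
  also have "\<dots> = x" using assms by (simp add: one_add_one)
  finally show ?thesis .
qed

text \<open>Idempotence leaves no nonzero element below \<open>\<zero>\<close>. This ideal is the
  starting member for Zorn's lemma.\<close>

lemma strong_ideal_singleton_zero: "strong_ideal A {\<zero>}"
proof (rule strong_idealI)
  fix x y assume xy: "x \<in> carrier A" "y \<in> carrier A" "x \<oplus> y \<in> {\<zero>}"
  then have "x = x \<oplus> (x \<oplus> y)" by simp
  also have "\<dots> = x \<oplus> y" using xy(1,2) by (simp add: add_idem flip: a_assoc)
  finally show "x \<in> {\<zero>}" using xy(3) by simp
qed auto

lemma strong_ideal_colon:
  assumes J: "strong_ideal A J" and z: "z \<in> carrier A"
  shows "strong_ideal A {y \<in> carrier A. y \<otimes> z \<in> J}"
  by (rule strong_idealI)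
    (use assms in \<open>auto simp: l_distr m_assoc strong_ideal_add_iff strong_ideal_zero
      strong_ideal_mult\<close>)

text \<open>Makes the colon ideal comparable with \<open>J\<close>, so that maximality can be
  applied to it.\<close>

lemma strong_ideal_subset_colon:
  assumes J: "strong_ideal A J" and z: "z \<in> carrier A"
  shows "J \<subseteq> {y \<in> carrier A. y \<otimes> z \<in> J}"
proof
  fix y assume y: "y \<in> J"
  then have "y \<in> carrier A" using J strong_ideal_subset by blast
  then show "y \<in> {y \<in> carrier A. y \<otimes> z \<in> J}"
    using strong_ideal_mult[OF J z y] z by (simp add: m_comm)
qed

section \<open>Prime ideals and nilpotent elements\<close>

text \<open>Primeness strips off one factor \<open>x\<close> at a time. The descent stops at
  \<open>x [^] 0 = \<one>\<close>, which a proper ideal cannot contain, so \<open>n = 0\<close> is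
  covered as well.\<close>

lemma prime_ideal_nilpotent:
  assumes P: "prime_ideal A P" and x: "x \<in> carrier A" and "x [^] (n::nat) = \<zero>"
  shows "x \<in> P"
proof -
  have one: "\<one> \<notin> P"
  proof
    assume "\<one> \<in> P"
    then have "a \<in> P" if "a \<in> carrier A" for a
      using P that unfolding prime_ideal_def semiring_ideal_def by (metis r_one)
    with P show False unfolding prime_ideal_def semiring_ideal_def by blast
  qed
  have "x [^] (k::nat) \<in> P \<Longrightarrow> x \<in> P" for k
    by (induction k) (use one P x in \<open>auto simp: prime_ideal_def\<close>)
  moreover have "\<zero> \<in> P" using P by (simp add: prime_ideal_def semiring_ideal_def)
  ultimately show ?thesis using assms(3) by metis
qed

lemma ex_strong_prime_ideal:
  assumes x: "x \<in> carrier A" and nonnil: "\<And>n::nat. x [^] n \<noteq> \<zero>"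
  obtains P where "prime_ideal A P" "strong_ideal A P" "x \<notin> P"
proof -
  define S where "S = {J. strong_ideal A J \<and> (\<forall>n::nat. x [^] n \<notin> J)}"
  have "{\<zero>} \<in> S"
    using strong_ideal_singleton_zero nonnil by (simp add: S_def)
  moreover have "\<Union>C \<in> S" if "C \<noteq> {}" "subset.chain S C" for C
    using that strong_ideal_Union_chain[of C A] unfolding S_def subset_chain_def by auto
  ultimately obtain P where P: "P \<in> S" and max: "\<forall>J\<in>S. P \<subseteq> J \<longrightarrow> J = P"
    using subset_Zorn_nonempty[of S] by blast
  have strong: "strong_ideal A P" and no_power: "\<And>n::nat. x [^] n \<notin> P"
    using P by (auto simp: S_def)
  \<comment> \<open>The colon ideal of \<open>P\<close> by \<open>b\<close> contains
    \<open>P\<close> and also \<open>a\<close>, which is not in \<open>P\<close>; being strictly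
    larger, it must contain a power of \<open>x\<close>.\<close>
  have colon: "\<exists>n::nat. x [^] n \<otimes> b \<in> P"
    if "a \<in> carrier A" "b \<in> carrier A" "a \<otimes> b \<in> P" "a \<notin> P" for a b
  proof (rule ccontr)
    assume "\<nexists>n::nat. x [^] n \<otimes> b \<in> P"
    then have "{y \<in> carrier A. y \<otimes> b \<in> P} \<in> S"
      using strong_ideal_colon[OF strong that(2)] by (simp add: S_def)
    with max strong_ideal_subset_colon[OF strong that(2)] that show False by blast
  qed
  have "a \<in> P \<or> b \<in> P" if ab: "a \<in> carrier A" "b \<in> carrier A" "a \<otimes> b \<in> P" for a b
  proof (rule ccontr)
    assume notin: "\<not> (a \<in> P \<or> b \<in> P)"
    with colon ab obtain n :: nat where "x [^] n \<otimes> b \<in> P" by blast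
    then have "b \<otimes> x [^] n \<in> P" using ab x by (simp add: m_comm)
    \<comment> \<open>Now \<open>b\<close> is the factor outside \<open>P\<close>, and
      \<open>x [^] n\<close> is outside \<open>P\<close> by the choice of \<open>S\<close>.\<close>
    with colon[of b "x [^] n"] ab x notin obtain m :: nat where "x [^] m \<otimes> x [^] n \<in> P" by auto
    with no_power x show False by (simp add: nat_pow_mult)
  qed
  moreover have "P \<noteq> carrier A" using no_power[of 0] by auto
  ultimately have "prime_ideal A P"
    using strong unfolding prime_ideal_def strong_ideal_def by blast
  moreover have "x \<notin> P" using no_power[of 1] x by simp
  ultimately show ?thesis using strong that by blast
qed

lemma Nil_set_subset_ideal_Inter: "Nil_set A \<subseteq> ideal_Inter A (Pr A)"
  using prime_ideal_nilpotent by (auto simp: Nil_set_def ideal_Inter_def Pr_def)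

lemma ideal_Inter_strong_primes_subset_Nil_set:
  "ideal_Inter A {P. prime_ideal A P \<and> strong_ideal A P} \<subseteq> Nil_set A"
proof
  fix x assume "x \<in> ideal_Inter A {P. prime_ideal A P \<and> strong_ideal A P}"
  then have x: "x \<in> carrier A" and "\<And>P. prime_ideal A P \<Longrightarrow> strong_ideal A P \<Longrightarrow> x \<in> P"
    by (auto simp: ideal_Inter_def)
  with ex_strong_prime_ideal obtain n :: nat where "x [^] n = \<zero>" by metis
  \<comment> \<open>The exponent \<open>n\<close> may be 0, when \<open>\<one> = \<zero>\<close>;
    one more factor \<open>x\<close> makes it positive, as \<open>Nil_set\<close> demands.\<close>
  with x have "x [^] Suc n = \<zero>" by simp
  moreover have "Suc n \<ge> 1" by simp
  ultimately show "x \<in> Nil_set A" using x unfolding Nil_set_def by blast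
qed

end

theorem theorem5p1:
  fixes A :: "('a, 'm) ring_scheme"
  assumes "B1_algebra A"
  shows "saturated_ideal A (Nil_set A) \<and>
         ideal_Inter A (Pr A) = ideal_Inter A (Pr_s A) \<and>
         ideal_Inter A (Pr_s A) = Nil_set A"
proof -
  interpret B1_algebra A by fact
  let ?S = "{P. prime_ideal A P \<and> strong_ideal A P}"
  have "ideal_Inter A (Pr A) \<subseteq> ideal_Inter A (Pr_s A)"
    by (auto simp: ideal_Inter_def Pr_def Pr_s_def)
  moreover have "ideal_Inter A (Pr_s A) \<subseteq> ideal_Inter A ?S"
    using strong_ideal_saturated by (auto simp: ideal_Inter_def Pr_s_def)
  \<comment> \<open>A cycle of inclusions closes: \<open>Nil_set A\<close>, then the intersections
    over \<open>Pr A\<close>, \<open>Pr_s A\<close> and \<open>?S\<close>, then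
    \<open>Nil_set A\<close> again.\<close>
  ultimately have "ideal_Inter A ?S = Nil_set A" "ideal_Inter A (Pr A) = Nil_set A"
    "ideal_Inter A (Pr_s A) = Nil_set A"
    using Nil_set_subset_ideal_Inter ideal_Inter_strong_primes_subset_Nil_set by blast+
  \<comment> \<open>Since this intersection equals \<open>Nil_set A\<close>, the nilpotents inherit
    downward closure and hence saturation.\<close>
  moreover have "strong_ideal A (ideal_Inter A ?S)"
    by (rule strong_ideal_ideal_Inter) (auto intro: semiring_axioms)
  ultimately show ?thesis using strong_ideal_saturated by simp
qed

end
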